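(* Let $k\ge 1$ be an integer, $m=2k+1$ and $n=2m=4k+2$. Let $M_n$ be the $n\times n$ singly even magic square generated by the Strachey method, and let $$\Lambda=\left\{\lambda_j=\frac{n^2}{4\sin(j\pi/m)} : j\in\{\pm1,\pm2,\ldots,\pm k\}\right\}.$$ Let $\mathbf 1_m\in\mathbb R^m$ be the all-ones column vector and $e_{k+1}\in\mathbb R^m$ the standard unit vector whose $(k+1)$-th entry is $1$. Then: 1. Two of the non-trivial eigenpairs of $M_n$ are $$\left(-3m^2,\begin{bmatrix}\mathbf 1_m\\-\mathbf 1_m\end{bmatrix}\right)\quad\text{and}\quad\left(3m^2,\begin{bmatrix}\mathbf 1_m-3e_{k+1}\\-(\mathbf 1_m-3e_{k+1})\end{bmatrix}\right).$$ 2. $2k-1$ of the non-trivial eigenvalues of $M_n$ (counted with multiplicity) are zero. 3. The set of the remaining $2k$ non-trivial eigenvalues of $M_n$ is $\frac2n$-approximated by $\Lambda$.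
   Context: For odd $m$, let $M_m$ be the odd magic square of the Siamese method, i.e. the $m\times m$ matrix with entries, for $i,j\in\{1,\ldots,m\}$, $$M_m(i,j)=m\left(\left(i+j+\tfrac{m-3}{2}\right)\bmod m\right)+\left((i+2j-2)\bmod m\right)+1,$$ where $x\bmod m$ denotes the residue in $\{0,\ldots,m-1\}$. The singly even magic square $M_n$ generated by the Strachey method (as implemented in MATLAB's magic(n)), with $n=2m$, $m=2k+1$, is obtained as follows. Let $E$ be the $m\times m$ all-ones matrix and start from $$A=\begin{bmatrix}M_m & M_m+2m^2E\\ M_m+3m^2E & M_m+m^2E\end{bmatrix}.$$ Then interchange the entries $A(i,j)$ and $A(i+m,j)$ for each of the following positions $(i,j)$ with $1\le i\le m$: (a) all $i\in\{1,\ldots,m\}$ and all $j\in\{2,\ldots,k\}\cup\{n-k+2,\ldots,n\}$ (no such $j$ if $k=1$); (b) all $i\in\{1,\ldots,m\}\setminus\{k+1\}$ and $j=1$; (c) $i=k+1$ and $j=k+1$. The resulting matrix is $M_n$. The all-ones vector of length $n$ is an eigenvector of $M_n$ with eigenvalue the magic sum $\mu_0=\frac{n(n^2+1)}{2}$; this is called the trivial eigenpair, and $\mu_0$ has multiplicity one. The non-trivial eigenvalues (eigenpairs) are the other $n-1$ eigenvalues counted with multiplicity (and their eigenpairs). In item 3, "remaining" means the non-trivial eigenvalues left, as a multiset, after removing the two eigenvalues $\pm 3m^2$ of item 1 and the $2k-1$ zeros of item 2. A set $P$ is said to be $\epsilon$-approximated by a set $Q$ if for each $p\in P$ there exists $q\in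 Q$ such that $\frac{|p-q|}{|q|}\le\epsilon$. *)

theory Defs
  imports "Jordan_Normal_Form.Char_Poly"
begin

text \<open>
  Matrices and vectors of \<^theory>\<open>Jordan_Normal_Form.Matrix\<close> are indexed from 0, whereas the
  entry formula and the interchange positions below are the usual ones with indices from 1; the
  shift takes place where the matrices are built. All matrices are complex, so that the roots of
  the characteristic polynomial are all the eigenvalues.
\<close>

text \<open>
  The subtractions on \<^typ>\<open>nat\<close> are harmless for odd \<open>m\<close> and \<open>i, j \<ge> 1\<close>: the only truncation
  is at \<open>m = 1\<close>, where everything is reduced modulo 1 anyway.
\<close>

definition siamese_entry :: "nat \<Rightarrow> nat \<Rightarrow> nat \<Rightarrow> nat" where
  "siamese_entry m i j =
     m * ((i + j + (m - 3) div 2) mod m) + ((i + 2 * j - 2) mod m) + 1"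

definition siamese :: "nat \<Rightarrow> complex mat" where
  "siamese m = mat m m (\<lambda>(i, j). of_nat (siamese_entry m (i + 1) (j + 1)))"

definition ones_mat :: "nat \<Rightarrow> complex mat" where
  "ones_mat m = mat m m (\<lambda>_. 1)"

definition ones_vec :: "nat \<Rightarrow> complex vec" where
  "ones_vec m = vec m (\<lambda>_. 1)"

definition strachey_start :: "nat \<Rightarrow> complex mat" where
  "strachey_start m =
     four_block_mat
       (siamese m)
       (siamese m + of_nat (2 * m\<^sup>2) \<cdot>\<^sub>m ones_mat m)
       (siamese m + of_nat (3 * m\<^sup>2) \<cdot>\<^sub>m ones_mat m)
       (siamese m + of_nat (m\<^sup>2) \<cdot>\<^sub>m ones_mat m)"

text \<open>
  Positions \<open>(i, j)\<close>, counted from 1 and with \<open>1 \<le> i \<le> m\<close>, whose entry is interchanged with the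
  one at \<open>(i + m, j)\<close>; here \<open>m = 2 * k + 1\<close> and \<open>n = 2 * m\<close>.
\<close>

definition strachey_swaps :: "nat \<Rightarrow> (nat \<times> nat) set" where
  "strachey_swaps k = (let m = 2 * k + 1; n = 2 * m in
     {1..m} \<times> ({2..k} \<union> {n - k + 2..n})
     \<union> ({1..m} - {k + 1}) \<times> {1}
     \<union> {(k + 1, k + 1)})"

definition strachey :: "nat \<Rightarrow> complex mat" where
  "strachey k = (let m = 2 * k + 1; n = 2 * m; A = strachey_start m in
     mat n n (\<lambda>(i, j).
       if i < m \<and> (i + 1, j + 1) \<in> strachey_swaps k then A $$ (i + m, j)
       else if m \<le> i \<and> (i - m + 1, j + 1) \<in> strachey_swaps k then A $$ (i - m, j)
       else A $$ (i, j)))"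

definition magic_sum :: "nat \<Rightarrow> complex" where
  "magic_sum n = of_nat n * (of_nat n ^ 2 + 1) / 2"

text \<open>
  Eigenvalues with algebraic multiplicity, one copy of the magic sum being removed.
\<close>

definition nontrivial_eigenvalues :: "complex mat \<Rightarrow> complex multiset" where
  "nontrivial_eigenvalues A = proots (char_poly A) - {#magic_sum (dim_row A)#}"

text \<open>The condition \<open>q \<noteq> 0\<close> excludes the convention \<open>x / 0 = 0\<close>.\<close>

definition approximated_by :: "real \<Rightarrow> complex set \<Rightarrow> complex set \<Rightarrow> bool" where
  "approximated_by \<epsilon> P Q \<longleftrightarrow> (\<forall>p\<in>P. \<exists>q\<in>Q. q \<noteq> 0 \<and> cmod (p - q) / cmod q \<le> \<epsilon>)"

definition Lambda_set :: "nat \<Rightarrow> complex set" where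
  "Lambda_set k = (let m = 2 * k + 1; n = 2 * m in
     {of_real (real n ^ 2 / (4 * sin (of_int j * pi / real m))) |j::int.
        j \<in> {- int k..int k} - {0}})"

end

theory Submission
  imports Defs
begin

text \<open>
  Write \<open>m = 2 * k + 1\<close>, let \<open>S\<close> be the Siamese square of order \<open>m\<close> and \<open>E\<close> the all-ones matrix.
  An interchange moves an entry only between the upper and the lower half of its column, so adding
  the two block rows of the Strachey square undoes all of them: both block columns add up to
  \<open>N = 2 S + 3 m\<^sup>2 E\<close>. Hence the map \<open>(x, y) \<mapsto> x + y\<close> carries the Strachey square to \<open>N\<close>, its kernel
  consists of the vectors \<open>(y, - y)\<close> and is invariant, and the spectrum is that of \<open>N\<close> together
  with that of the difference \<open>D\<close> of the two upper blocks, which is the action on the kernel.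
  \<open>char_poly_intertwined_block\<close> and \<open>strachey_block_structure\<close> express this.

  In \<open>D\<close> the square \<open>S\<close> cancels and only the interchange pattern survives. All rows agree except
  the middle one, so \<open>D\<close> has rank 2 and factors through a space of dimension 2; Sylvester's identity
  (\<open>sylvester_char_poly\<close>) reduces its characteristic polynomial to a triangular \<open>2 \<times> 2\<close> matrix
  with diagonal \<open>- 3 m\<^sup>2, 3 m\<^sup>2\<close>, leaving \<open>2 k - 1\<close> zeros.

  The columns of \<open>N\<close> each add up to the magic sum, which splits off one eigenvalue
  (\<open>const_column_sum_deflation\<close>) and leaves the action of \<open>N\<close> on the vectors with entry sum 0. There constant matrices act as 0 and \<open>N\<close> becomes
  \<open>H (1 + P / m)\<close>, where \<open>H = 2 m B\<close> with a Hankel matrix \<open>B\<close> built from a sawtooth and \<open>P\<close> is the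
  permutation \<open>t \<mapsto> 2 t + 1 + k\<close> modulo \<open>m\<close>. The non-constant real Hartley vectors \<open>cos + sin\<close>
  form an orthogonal eigenbasis of \<open>H\<close> there (\<open>sum_sawtooth_hartley\<close>), with
  eigenvalues \<open>\<plusminus> m\<^sup>2 / sin (\<pi> j / m)\<close>: these are exactly the elements of
  \<open>\<Lambda>\<close>. The permutation preserves the norm, so \<open>N\<close> is a perturbation of \<open>H\<close> of relative
  size \<open>1 / m = 2 / n\<close>, and the relative Bauer-Fike bound for normal matrices
  (\<open>relative_perturbation_bound\<close>) finishes the proof.
\<close>

section \<open>Invariant subspaces and characteristic polynomials\<close>

lemma char_poly_block_upper_triangular:
  fixes A :: "'a :: idom mat"
  assumes A: "A \<in> carrier_mat n n" and B: "B \<in> carrier_mat n m" and D: "D \<in> carrier_mat m m"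
  shows "char_poly (four_block_mat A B (0\<^sub>m m n) D) = char_poly A * char_poly D"
proof -
  have "char_poly_matrix (four_block_mat A B (0\<^sub>m m n) D) =
      four_block_mat (char_poly_matrix A) (map_mat (\<lambda>a. [:- a:]) B) (0\<^sub>m m n) (char_poly_matrix D)"
    by (rule eq_matI) (use A B D in \<open>auto simp: char_poly_matrix_def one_poly_def\<close>)
  also have "det \<dots> = det (char_poly_matrix A) * det (char_poly_matrix D)"
    by (rule det_four_block_mat_lower_left_zero[of _ n _ m]) (use A B D in auto)
  finally show ?thesis unfolding char_poly_def .
qed

text \<open>
  The hypotheses say that \<open>[K 1] * M = N * [K 1]\<close> for the block matrix \<open>M\<close>: the quotient map
  \<open>(x, y) \<mapsto> K x + y\<close> intertwines \<open>M\<close> with \<open>N\<close>. Its kernel consists of the vectors \<open>(y, - K y)\<close>, on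
  which \<open>M\<close> acts as \<open>R\<close>. Conjugating by a unitriangular matrix makes \<open>M\<close> block triangular with \<open>R\<close>
  and \<open>N\<close> on the diagonal.
\<close>

lemma char_poly_intertwined_block:
  fixes A :: "'a :: idom mat"
  assumes R: "R \<in> carrier_mat p p" and B: "B \<in> carrier_mat p q" and C: "C \<in> carrier_mat q p"
    and D: "D \<in> carrier_mat q q" and K: "K \<in> carrier_mat q p" and N: "N \<in> carrier_mat q q"
    and A_eq: "A = R + B * K" and N_left: "K * A + C = N * K" and N_right: "K * B + D = N"
  shows "char_poly (four_block_mat A B C D) = char_poly R * char_poly N"
proof -
  have A: "A \<in> carrier_mat p p"
    using R B K unfolding A_eq by simp
  let ?P = "four_block_mat (1\<^sub>m p) (0\<^sub>m p q) (- K) (1\<^sub>m q)"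
  let ?Q = "four_block_mat (1\<^sub>m p) (0\<^sub>m p q) K (1\<^sub>m q)"
  let ?T = "four_block_mat R B (0\<^sub>m q p) N"
  have "K + - K = 0\<^sub>m q p" "- K + K = 0\<^sub>m q p" "- 0\<^sub>m p p = (0\<^sub>m p p :: 'a mat)"
    using K by (auto intro!: eq_matI)
  then have PQ: "?P * ?Q = 1\<^sub>m (p + q)" and QP: "?Q * ?P = 1\<^sub>m (p + q)"
    using K
    by (simp_all add: mult_four_block_mat[of _ p p _ q _ q _ _ p _ q])
  have KA: "K * A \<in> carrier_mat q p" and KB: "K * B \<in> carrier_mat q q"
    using K A B by auto
  have "?T * ?Q = four_block_mat A B (N * K) N"
    using R B N K by (simp add: mult_four_block_mat[of _ p p _ q _ q _ _ p _ q] A_eq)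
  then have "?P * (?T * ?Q) = ?P * four_block_mat A B (N * K) N"
    by simp
  also have "\<dots> = four_block_mat A B (- K * A + N * K) (- K * B + N)"
    using A B N K by (simp add: mult_four_block_mat[of _ p p _ q _ q _ _ p _ q])
  also have "- K * A + N * K = C"
    unfolding N_left[symmetric] using K A C KA by (intro eq_matI) auto
  also have "- K * B + N = D"
    unfolding N_right[symmetric] using K B D KB by (intro eq_matI) auto
  finally have "four_block_mat A B C D = ?P * ?T * ?Q"
    using assoc_mult_mat[of ?P "p + q" "p + q" ?T "p + q" ?Q "p + q"] R N K by simp
  then have "similar_mat (four_block_mat A B C D) ?T"
    using A D R N K by (intro similar_matI[OF _ PQ QP]) auto
  from char_poly_similar[OF this] show ?thesis
    using char_poly_block_upper_triangular[OF R B N] by simp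
qed

text \<open>
  The action on the kernel of the quotient map, which transports eigenvectors of \<open>R\<close> to the
  whole matrix.
\<close>

lemma mult_vec_intertwined_block:
  fixes A :: "'a :: idom mat"
  assumes R: "R \<in> carrier_mat p p" and B: "B \<in> carrier_mat p q" and C: "C \<in> carrier_mat q p"
    and D: "D \<in> carrier_mat q q" and K: "K \<in> carrier_mat q p" and N: "N \<in> carrier_mat q q"
    and A_eq: "A = R + B * K" and N_left: "K * A + C = N * K" and N_right: "K * B + D = N"
    and y: "y \<in> carrier_vec p"
  shows "four_block_mat A B C D *\<^sub>v (y @\<^sub>v - (K *\<^sub>v y)) = R *\<^sub>v y @\<^sub>v - (K *\<^sub>v (R *\<^sub>v y))"
proof -
  have A: "A \<in> carrier_mat p p"
    using R B K unfolding A_eq by simp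
  have Ky: "K *\<^sub>v y \<in> carrier_vec q" and BKy: "B *\<^sub>v (K *\<^sub>v y) \<in> carrier_vec p"
    and Ry: "R *\<^sub>v y \<in> carrier_vec p"
    using K B R y by auto
  have neg: "X *\<^sub>v (- u) = - (X *\<^sub>v u)" if "X \<in> carrier_mat r q" "u \<in> carrier_vec q"
    for X :: "'a mat" and u r
    using that by (intro eq_vecI) auto
  have Ay: "A *\<^sub>v y = R *\<^sub>v y + B *\<^sub>v (K *\<^sub>v y)"
    unfolding A_eq using R B K y by (simp add: add_mult_distrib_mat_vec[of _ p p])
  have top: "A *\<^sub>v y + B *\<^sub>v (- (K *\<^sub>v y)) = R *\<^sub>v y"
    unfolding Ay neg[OF B Ky] using Ry BKy by (intro eq_vecI) auto
  have "(K * A + C) *\<^sub>v y = (K * B + D) *\<^sub>v (K *\<^sub>v y)"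
    unfolding N_left N_right using N K y by simp
  then have inter: "K *\<^sub>v (R *\<^sub>v y) + K *\<^sub>v (B *\<^sub>v (K *\<^sub>v y)) + C *\<^sub>v y
      = K *\<^sub>v (B *\<^sub>v (K *\<^sub>v y)) + D *\<^sub>v (K *\<^sub>v y)"
    using K A B C D y Ky Ry BKy Ay
    by (simp add: add_mult_distrib_mat_vec[of _ q p] add_mult_distrib_mat_vec[of _ q q]
        mult_add_distrib_mat_vec[of _ q p])
  have car: "K *\<^sub>v (R *\<^sub>v y) \<in> carrier_vec q" "K *\<^sub>v (B *\<^sub>v (K *\<^sub>v y)) \<in> carrier_vec q"
    "C *\<^sub>v y \<in> carrier_vec q" "D *\<^sub>v (K *\<^sub>v y) \<in> carrier_vec q"
    using K C D y Ky Ry BKy by auto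
  have bottom: "C *\<^sub>v y + D *\<^sub>v (- (K *\<^sub>v y)) = - (K *\<^sub>v (R *\<^sub>v y))"
  proof (rule eq_vecI)
    fix i assume "i < dim_vec (- (K *\<^sub>v (R *\<^sub>v y)))"
    then have i: "i < q" using K by simp
    from arg_cong[OF inter, of "\<lambda>u. u $ i"]
    have "(K *\<^sub>v (R *\<^sub>v y)) $ i + (C *\<^sub>v y) $ i = (D *\<^sub>v (K *\<^sub>v y)) $ i"
      using i car C D K by (simp del: index_mult_mat_vec add: algebra_simps)
    then show "(C *\<^sub>v y + D *\<^sub>v (- (K *\<^sub>v y))) $ i = (- (K *\<^sub>v (R *\<^sub>v y))) $ i"
      unfolding neg[OF D Ky] using i car C D K
      by (simp del: index_mult_mat_vec flip: \<open>_ = (D *\<^sub>v (K *\<^sub>v y)) $ i\<close>)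
  qed (use car D K in auto)
  show ?thesis
    unfolding four_block_mat_mult_vec[OF A B C D y uminus_carrier_vec[THEN iffD2, OF Ky]] top bottom ..
qed

text \<open>
  The block matrix with rows \<open>(0, V)\<close> and \<open>(0, U * V)\<close> is block triangular as it stands, and the
  intertwining \<open>K = - U\<close> exhibits \<open>V * U\<close> and 0 as a second pair of diagonal blocks.
\<close>

lemma sylvester_char_poly:
  fixes U V :: "'a :: idom mat"
  assumes U: "U \<in> carrier_mat m r" and V: "V \<in> carrier_mat r m"
  shows "[:0, 1:] ^ r * char_poly (U * V) = [:0, 1:] ^ m * char_poly (V * U)"
proof -
  have zero: "char_poly (0\<^sub>m d d :: 'a mat) = [:0, 1:] ^ d" for d
  proof -
    have "diag_mat (0\<^sub>m d d :: 'a mat) = replicate d 0"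
      by (auto simp: diag_mat_def intro!: nth_equalityI)
    then show ?thesis
      by (subst char_poly_upper_triangular[of _ d]) auto
  qed
  have "char_poly (four_block_mat (0\<^sub>m r r) V (0\<^sub>m m r) (U * V)) = char_poly (V * U) * char_poly (0\<^sub>m m m)"
    by (rule char_poly_intertwined_block[of _ r _ m _ _ "- U"])
      (use U V in \<open>auto intro!: eq_matI\<close>)
  moreover have "char_poly (four_block_mat (0\<^sub>m r r) V (0\<^sub>m m r) (U * V))
      = char_poly (0\<^sub>m r r) * char_poly (U * V)"
    by (rule char_poly_block_upper_triangular) (use U V in auto)
  ultimately show ?thesis
    by (simp add: zero mult.commute)
qed

text \<open>
  Here the quotient map is the entry sum. Multiplicities are kept: even if \<open>c\<close> occurs again as a
  root of \<open>char_poly R\<close>, it still has an eigenvector with entry sum 0.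
\<close>

lemma const_column_sum_deflation:
  fixes N :: "'a :: field mat"
  assumes N: "N \<in> carrier_mat (Suc d) (Suc d)"
    and col: "\<And>j. j < Suc d \<Longrightarrow> (\<Sum>i<Suc d. N $$ (i, j)) = c"
  obtains R where "R \<in> carrier_mat d d" and "char_poly N = char_poly R * [:- c, 1:]"
    and "\<And>z. poly (char_poly R) z = 0 \<Longrightarrow>
      \<exists>x. x \<in> carrier_vec (Suc d) \<and> x \<noteq> 0\<^sub>v (Suc d) \<and> N *\<^sub>v x = z \<cdot>\<^sub>v x \<and> (\<Sum>i<Suc d. x $ i) = 0"
proof -
  obtain A B C D where split: "split_block N d d = (A, B, C, D)"
    by (metis prod_cases4)
  have A: "A \<in> carrier_mat d d" and B: "B \<in> carrier_mat d 1" and C: "C \<in> carrier_mat 1 d"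
    and D: "D \<in> carrier_mat 1 1" and N_eq: "N = four_block_mat A B C D"
    using split_block[OF split, of 1 1] N by auto
  define K :: "'a mat" where "K = mat 1 d (\<lambda>_. 1)"
  define N' :: "'a mat" where "N' = mat 1 1 (\<lambda>_. c)"
  define R where "R = A - B * K"
  have K: "K \<in> carrier_mat 1 d" and N': "N' \<in> carrier_mat 1 1" and R: "R \<in> carrier_mat d d"
    using A B by (auto simp: K_def N'_def R_def)
  have A_eq: "A = R + B * K"
    using A B K by (intro eq_matI) (auto simp: R_def)
  have colA: "(\<Sum>i<d. A $$ (i, j)) + C $$ (0, j) = c" if "j < d" for j
    using col[of j] that A B C D by (simp add: N_eq)
  have colB: "(\<Sum>i<d. B $$ (i, 0)) + D $$ (0, 0) = c"
    using col[of d] A B C D by (simp add: N_eq)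
  have left: "K * A + C = N' * K"
    using A C K N' colA
    by (intro eq_matI) (auto simp: K_def N'_def scalar_prod_def atLeast0LessThan)
  have right: "K * B + D = N'"
    using B D K N' colB
    by (intro eq_matI) (auto simp: K_def N'_def scalar_prod_def atLeast0LessThan)
  have "char_poly N' = [:- c, 1:]"
    by (subst char_poly_upper_triangular[of _ 1]) (auto simp: N'_def diag_mat_def)
  then have cp: "char_poly N = char_poly R * [:- c, 1:]"
    using char_poly_intertwined_block[OF R B C D K N' A_eq left right] N_eq by simp
  have "\<exists>x. x \<in> carrier_vec (Suc d) \<and> x \<noteq> 0\<^sub>v (Suc d) \<and> N *\<^sub>v x = z \<cdot>\<^sub>v x \<and> (\<Sum>i<Suc d. x $ i) = 0"
    if "poly (char_poly R) z = 0" for z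
  proof -
    from that obtain y where y: "y \<in> carrier_vec d" "y \<noteq> 0\<^sub>v d" "R *\<^sub>v y = z \<cdot>\<^sub>v y"
      using eigenvalue_root_char_poly[OF R] R unfolding eigenvalue_def eigenvector_def by auto
    let ?x = "y @\<^sub>v - (K *\<^sub>v y)"
    have "N *\<^sub>v ?x = z \<cdot>\<^sub>v ?x"
      unfolding N_eq mult_vec_intertwined_block[OF R B C D K N' A_eq left right y(1)] y(3)
      using y(1) K by (intro eq_vecI) (auto simp: scalar_prod_def sum_distrib_left algebra_simps)
    moreover have "?x \<noteq> 0\<^sub>v (Suc d)"
    proof
      assume "?x = 0\<^sub>v (Suc d)"
      then have "y $ i = 0" if "i < d" for i
      proof -
        have "y $ i = ?x $ i"
          using that y(1) K by simp
        with \<open>?x = 0\<^sub>v (Suc d)\<close> show ?thesis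
          using that by simp
      qed
      then show False
        using y(1,2) by (metis carrier_vecD eq_vecI index_zero_vec)
    qed
    moreover have "(\<Sum>i<Suc d. ?x $ i) = 0"
      using y(1) K by (simp add: K_def scalar_prod_def atLeast0LessThan)
    moreover have "?x \<in> carrier_vec (Suc d)"
      using append_carrier_vec[of y d "- (K *\<^sub>v y)" 1] y(1) K by simp
    ultimately show ?thesis by blast
  qed
  with R cp show ?thesis by (rule that)
qed

section \<open>The discrete Hartley transform\<close>

text \<open>
  The kernel \<open>cas\<close> of the discrete Hartley transform. The second index is an integer so that
  vectors can be centred at position \<open>k\<close>.
\<close>

definition hartley :: "nat \<Rightarrow> nat \<Rightarrow> int \<Rightarrow> real" where
  "hartley m j r = cos (2 * pi * j * r / m) + sin (2 * pi * j * r / m)"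

lemma cis_int_multiple_eq_1_iff:
  assumes "m > 0"
  shows "cis (2 * pi * of_int r / real m) = 1 \<longleftrightarrow> int m dvd r"
proof -
  let ?t = "2 * pi * of_int r / real m"
  have "cis ?t = 1 \<longleftrightarrow> cos ?t = 1"
    by (auto simp: complex_eq_iff dest: cos_one_sin_zero)
  also have "\<dots> \<longleftrightarrow> (\<exists>q::int. ?t = of_int q * 2 * pi)"
    by (rule cos_one_2pi_int)
  also have "\<dots> \<longleftrightarrow> (\<exists>q::int. of_int r = (of_int (int m * q) :: real))"
    using assms by (intro ex_cong1) (auto simp: field_simps)
  also have "\<dots> \<longleftrightarrow> int m dvd r"
    unfolding of_int_eq_iff dvd_def by simp
  finally show ?thesis .
qed

lemma sum_cis_full_period:
  assumes "m > 0"
  shows "(\<Sum>j<m. cis (2 * pi * real j * of_int r / real m)) = (if int m dvd r then of_nat m else 0)"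
proof -
  define z where "z = cis (2 * pi * of_int r / real m)"
  have pow: "cis (2 * pi * real j * of_int r / real m) = z ^ j" for j
    unfolding z_def DeMoivre by (simp add: mult_ac)
  have "z ^ m = 1"
    unfolding z_def DeMoivre using assms by (simp add: complex_eq_iff cos_int_2pin sin_int_2pin)
  moreover have "z = 1 \<longleftrightarrow> int m dvd r"
    unfolding z_def using assms by (rule cis_int_multiple_eq_1_iff)
  ultimately show ?thesis
    unfolding pow by (auto simp: sum_gp_strict)
qed

lemma hartley_cong:
  assumes "m > 0" and "int m dvd r - s"
  shows "hartley m j r = hartley m j s"
proof -
  from assms(2) obtain q where "r = s + int m * q"
    by (metis dvdE add.commute diff_add_cancel)
  then have "2 * pi * j * r / m = 2 * pi * j * s / m + 2 * pi * of_int (int j * q)"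
    using assms(1) by (simp add: field_simps)
  then show ?thesis
    unfolding hartley_def by (simp only: cos_add sin_add cos_int_2pin sin_int_2pin)
qed

text \<open>
  By the addition theorems the product is \<open>cos\<close> of the difference plus \<open>sin\<close> of the sum of the
  angles; over a full period the sines always cancel.
\<close>

lemma hartley_orthogonal:
  assumes "m > 0"
  shows "(\<Sum>j<m. hartley m j r * hartley m j s) = (if int m dvd r - s then m else 0)"
proof -
  have "hartley m j r * hartley m j s
      = Re (cis (2 * pi * real j * of_int (r - s) / real m)) + Im (cis (2 * pi * real j * of_int (r + s) / real m))"
    for j
    by (simp add: hartley_def cos_diff sin_add ring_distribs diff_divide_distrib add_divide_distrib)
  then have "(\<Sum>j<m. hartley m j r * hartley m j s)
      = Re (\<Sum>j<m. cis (2 * pi * real j * of_int (r - s) / real m))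
        + Im (\<Sum>j<m. cis (2 * pi * real j * of_int (r + s) / real m))"
    by (simp only: sum.distrib Re_sum Im_sum)
  then show ?thesis
    unfolding sum_cis_full_period[OF assms] by simp
qed

text \<open>
  The sampling points \<open>r t\<close> may be any system of representatives modulo \<open>m\<close>, so the same statement
  covers a vector and its permuted copy.
\<close>

lemma hartley_parseval:
  fixes x :: "nat \<Rightarrow> complex" and r :: "nat \<Rightarrow> int"
  assumes "m > 0"
    and inj: "\<And>s t. s < m \<Longrightarrow> t < m \<Longrightarrow> int m dvd r s - r t \<Longrightarrow> s = t"
  shows "(\<Sum>j<m. (cmod (\<Sum>t<m. hartley m j (r t) * x t))\<^sup>2) = m * (\<Sum>t<m. (cmod (x t))\<^sup>2)"
proof -
  have "complex_of_real (\<Sum>j<m. (cmod (\<Sum>t<m. hartley m j (r t) * x t))\<^sup>2)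
      = (\<Sum>j<m. \<Sum>s<m. \<Sum>t<m. of_real (hartley m j (r s) * hartley m j (r t)) * (x s * cnj (x t)))"
    by (simp add: complex_norm_square sum_product mult_ac del: of_real_power)
  also have "\<dots> = (\<Sum>s<m. \<Sum>t<m. of_real (\<Sum>j<m. hartley m j (r s) * hartley m j (r t)) * (x s * cnj (x t)))"
    by (subst sum.swap, rule sum.cong[OF refl], subst sum.swap) (simp add: sum_distrib_right)
  also have "\<dots> = (\<Sum>s<m. \<Sum>t<m. if s = t then of_nat m * (x s * cnj (x s)) else 0)"
    using inj assms(1) by (intro sum.cong refl) (auto simp: hartley_orthogonal)
  also have "\<dots> = of_nat m * (\<Sum>s<m. x s * cnj (x s))"
    by (simp add: sum_distrib_left)
  also have "\<dots> = of_real (m * (\<Sum>t<m. (cmod (x t))\<^sup>2))"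
    by (simp add: complex_norm_square del: of_real_power)
  finally show ?thesis
    using of_real_eq_iff by blast
qed

section \<open>The sawtooth Hankel matrix\<close>

text \<open>
  Eigenvalue of the Hankel matrix of the sawtooth \<open>s - k\<close> on the Hartley vector with
  frequency \<open>0 < j < m\<close>.
\<close>

definition sawtooth_coeff :: "nat \<Rightarrow> nat \<Rightarrow> real" where
  "sawtooth_coeff m j = (-1) ^ (j + 1) * m / (2 * sin (pi * j / m))"

text \<open>
  Summation by parts against the geometric series. That the value is purely imaginary reflects the
  oddness of the sawtooth \<open>s - k\<close> on \<open>0, \<dots>, 2 * k\<close>.
\<close>

lemma sum_sawtooth_cis:
  assumes m: "m = 2 * k + 1" and j: "0 < j" "j < m"
  shows "(\<Sum>s<m. of_int (int s - int k) * cis (2 * pi * real j * of_int (int s - int k) / real m))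
    = \<i> * of_real (sawtooth_coeff m j)"
proof -
  define \<theta> where "\<theta> = pi * real j / real m"
  define z where "z = cis (2 * \<theta>)"
  have m0: "real m > 0" using m by simp
  have sin: "sin \<theta> \<noteq> 0"
    using j m0 sin_gt_zero[of \<theta>] by (auto simp: \<theta>_def field_simps)
  have z1: "z \<noteq> 1"
  proof
    assume "z = 1"
    then have "cos (2 * \<theta>) = 1" by (simp add: z_def complex_eq_iff)
    with sin show False by (simp add: cos_double_sin)
  qed
  have "real m * (2 * \<theta>) = 2 * pi * of_int (int j)"
    using m0 by (simp add: \<theta>_def)
  then have zm: "z ^ m = 1"
    unfolding z_def DeMoivre by (simp only: complex_eq_iff cis.sel one_complex.sel cos_int_2pin sin_int_2pin)
  have pow: "cis (2 * pi * real j * of_int (int s - int k) / real m) = cis (- (2 * real k * \<theta>)) * z ^ s" for s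
    unfolding z_def DeMoivre cis_mult \<theta>_def using m0 by (simp add: field_simps)
  have geo: "(\<Sum>s<m. z ^ s) = 0"
    using z1 zm by (simp add: sum_gp_strict)
  have "(z - 1) * (\<Sum>s<m. of_nat s * z ^ s)
      = (\<Sum>s<m. of_nat (Suc s) * z ^ Suc s - of_nat s * z ^ s) - z * (\<Sum>s<m. z ^ s)"
    by (simp add: sum_distrib_left sum_subtractf[symmetric] algebra_simps)
  also have "(\<Sum>s<m. of_nat (Suc s) * z ^ Suc s - of_nat s * z ^ s) = of_nat m * z ^ m"
    using sum_lessThan_telescope[of "\<lambda>s. of_nat s * z ^ s" m] by simp
  finally have tele: "(\<Sum>s<m. of_nat s * z ^ s) = of_nat m / (z - 1)"
    using z1 geo zm by (simp add: field_simps)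
  \<comment> \<open>Half-angle form of the geometric denominator; it produces the sine in the eigenvalue.\<close>
  have z_split: "z - 1 = cis \<theta> * (2 * \<i> * of_real (sin \<theta>))"
    by (simp add: z_def complex_eq_iff cos_double_sin sin_double power2_eq_square)
  \<comment> \<open>The half angle of the denominator completes the shift by \<open>k\<close> to the full angle \<open>m * \<theta>\<close>, leaving only a sign.\<close>
  have "(2 * real k + 1) * \<theta> = pi * real j"
    using m m0 by (simp add: \<theta>_def field_simps)
  then have "cis (2 * real k * \<theta>) * cis \<theta> = cis (pi * real j)"
    unfolding cis_mult by (simp add: algebra_simps)
  also have "\<dots> = (-1) ^ j"
    by (simp add: complex_eq_iff cos_npi2 sin_npi2)
  finally have sign0: "cis (2 * real k * \<theta>) * cis \<theta> = (-1) ^ j" .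
  have sign: "cis (- (2 * real k * \<theta>)) / cis \<theta> = (-1) ^ j"
  proof -
    have "cis (- (2 * real k * \<theta>)) / cis \<theta> = inverse (cis (2 * real k * \<theta>) * cis \<theta>)"
      by (simp add: divide_inverse)
    also have "\<dots> = (-1) ^ j"
      unfolding sign0 by (simp flip: power_inverse)
    finally show ?thesis .
  qed
  have "(\<Sum>s<m. of_int (int s - int k) * cis (2 * pi * real j * of_int (int s - int k) / real m))
      = cis (- (2 * real k * \<theta>)) * ((\<Sum>s<m. of_nat s * z ^ s) - of_nat k * (\<Sum>s<m. z ^ s))"
    unfolding pow by (simp add: sum_distrib_left sum_subtractf[symmetric] algebra_simps)
  also have "\<dots> = (cis (- (2 * real k * \<theta>)) / cis \<theta>) * (of_nat m / (2 * \<i> * of_real (sin \<theta>)))"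
    unfolding tele geo z_split by simp
  also have "\<dots> = \<i> * of_real (sawtooth_coeff m j)"
    unfolding sign sawtooth_coeff_def \<theta>_def[symmetric] using sin by (simp add: field_simps)
  finally show ?thesis .
qed

lemma sum_shift_mod:
  fixes f :: "int \<Rightarrow> 'a :: comm_monoid_add"
  assumes "m > 0"
  shows "(\<Sum>i<m. f ((int i + r) mod int m)) = (\<Sum>s<m. f (int s))"
  by (rule sum.reindex_bij_witness[where i = "\<lambda>s. nat ((int s - r) mod int m)"
        and j = "\<lambda>i. nat ((int i + r) mod int m)"])
    (use assms in \<open>auto simp: nat_less_iff mod_simps\<close>)

lemma sum_sawtooth: "(\<Sum>s<2 * k + 1. complex_of_int (int s - int k)) = 0"
proof -
  have "(\<Sum>s<2 * k + 1. complex_of_nat s) = of_nat (k * (2 * k + 1))"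
    by (induction k) (auto simp: algebra_simps)
  then show ?thesis
    by (simp add: sum_subtractf algebra_simps)
qed

lemma sum_hartley_eq_0:
  assumes "0 < j" "j < m"
  shows "(\<Sum>i<m. hartley m j (int i - r)) = 0"
proof -
  have "hartley m j (int i - r) = hartley m j ((int i + (- r)) mod int m)" for i
  proof (rule hartley_cong)
    show "int m dvd int i - r - (int i + - r) mod int m"
      using dvd_minus_mod[of "int m" "int i - r"] by simp
  qed (use assms in simp)
  then have "(\<Sum>i<m. hartley m j (int i - r)) = (\<Sum>s<m. hartley m j (int s))"
    using sum_shift_mod[of m "hartley m j" "- r"] assms by simp
  also have "\<dots> = Re (\<Sum>s<m. cis (2 * pi * real s * of_int (int j) / real m))
      + Im (\<Sum>s<m. cis (2 * pi * real s * of_int (int j) / real m))"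
    by (simp add: hartley_def sum.distrib mult_ac)
  also have "\<dots> = 0"
    using assms by (subst (1 2) sum_cis_full_period) (auto dest: zdvd_imp_le)
  finally show ?thesis .
qed

text \<open>
  Every Hartley vector of non-zero frequency is an eigenvector of the sawtooth Hankel matrix: after a shift of the summation
  index, the Fourier coefficient of the sawtooth is \<open>\<i>\<close> times a real number, and multiplication by
  \<open>\<i>\<close> turns \<open>cos - sin\<close> of the shift into \<open>cos + sin\<close>.
\<close>

lemma sum_sawtooth_hartley:
  assumes m: "m = 2 * k + 1" and j: "0 < j" "j < m"
  shows "(\<Sum>i<m. of_int ((int i + r) mod int m - int k) * hartley m j (int i - int k))
    = sawtooth_coeff m j * hartley m j r"
proof -
  let ?\<theta> = "\<lambda>a. 2 * pi * real j * of_int a / real m"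
  have m0: "m > 0" using m by simp
  have "hartley m j (int i - int k) = hartley m j ((int i + r) mod int m - int k - r)" for i
  proof (rule hartley_cong[OF m0])
    have "int i - int k - ((int i + r) mod int m - int k - r) = (int i + r) - (int i + r) mod int m"
      by simp
    then show "int m dvd int i - int k - ((int i + r) mod int m - int k - r)"
      by (metis dvd_minus_mod)
  qed
  then have "(\<Sum>i<m. of_int ((int i + r) mod int m - int k) * hartley m j (int i - int k))
      = (\<Sum>s<m. of_int (int s - int k) * hartley m j (int s - int k - r))"
    using sum_shift_mod[OF m0, of "\<lambda>a. of_int (a - int k) * hartley m j (a - int k - r)" r] by simp
  also have "\<dots> = (\<Sum>s<m. Re (of_int (int s - int k) * cis (?\<theta> (int s - int k)) * cis (- ?\<theta> r))
      + Im (of_int (int s - int k) * cis (?\<theta> (int s - int k)) * cis (- ?\<theta> r)))"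
    unfolding hartley_def
    by (intro sum.cong refl)
      (simp add: mult.assoc cis_mult right_diff_distrib diff_divide_distrib ring_distribs del: cis_divide)
  also have "\<dots> = Re ((\<Sum>s<m. of_int (int s - int k) * cis (?\<theta> (int s - int k))) * cis (- ?\<theta> r))
      + Im ((\<Sum>s<m. of_int (int s - int k) * cis (?\<theta> (int s - int k))) * cis (- ?\<theta> r))"
    unfolding sum_distrib_right Re_sum Im_sum sum.distrib ..
  also have "\<dots> = sawtooth_coeff m j * hartley m j r"
    unfolding sum_sawtooth_cis[OF m j] by (simp add: hartley_def algebra_simps)
  finally show ?thesis .
qed

section \<open>A relative perturbation bound\<close>

text \<open>
  The relative Bauer-Fike bound in the coordinates of an orthonormal eigenbasis: \<open>a\<close> holds the
  coordinates of an eigenvector and \<open>b\<close> those of its image under an isometry. If \<open>z\<close> were far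
  from every \<open>q j\<close> with \<open>a j \<noteq> 0\<close>, each such coordinate would grow strictly, against equality of norms.
\<close>

lemma relative_perturbation_bound:
  fixes a b q :: "'b \<Rightarrow> complex" and \<epsilon> :: real
  assumes J: "finite J" and \<epsilon>: "\<epsilon> \<ge> 0"
    and eq: "\<And>j. j \<in> J \<Longrightarrow> (z - q j) * a j = of_real \<epsilon> * q j * b j"
    and norms: "(\<Sum>j\<in>J. (cmod (a j))\<^sup>2) = (\<Sum>j\<in>J. (cmod (b j))\<^sup>2)"
    and nonzero: "\<exists>j\<in>J. a j \<noteq> 0"
  shows "\<exists>j\<in>J. a j \<noteq> 0 \<and> cmod (z - q j) \<le> \<epsilon> * cmod (q j)"
proof (rule ccontr)
  assume "\<not> ?thesis"
  then have far: "\<epsilon> * cmod (q j) < cmod (z - q j)" if "j \<in> J" "a j \<noteq> 0" for j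
    using that by force
  have less: "cmod (a j) < cmod (b j)" if "j \<in> J" "a j \<noteq> 0" for j
  proof (rule ccontr)
    assume "\<not> cmod (a j) < cmod (b j)"
    then have "\<epsilon> * cmod (q j) * cmod (b j) \<le> \<epsilon> * cmod (q j) * cmod (a j)"
      using \<epsilon> by (intro mult_left_mono) auto
    also have "\<dots> < cmod (z - q j) * cmod (a j)"
      using far that by simp
    also have "\<dots> = \<epsilon> * cmod (q j) * cmod (b j)"
      using arg_cong[OF eq[OF that(1)], of cmod] \<epsilon> by (simp add: norm_mult)
    finally show False by simp
  qed
  have "(\<Sum>j\<in>J. (cmod (a j))\<^sup>2) < (\<Sum>j\<in>J. (cmod (b j))\<^sup>2)"
  proof (rule sum_strict_mono_ex1[OF J])
    show "\<forall>j\<in>J. (cmod (a j))\<^sup>2 \<le> (cmod (b j))\<^sup>2"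
    proof
      fix j assume "j \<in> J"
      then show "(cmod (a j))\<^sup>2 \<le> (cmod (b j))\<^sup>2"
        using less[of j] by (cases "a j = 0") (auto intro!: power_mono)
    qed
    show "\<exists>j\<in>J. (cmod (a j))\<^sup>2 < (cmod (b j))\<^sup>2"
    proof -
      from nonzero obtain j where "j \<in> J" "a j \<noteq> 0" by blast
      with less show ?thesis by (intro bexI[of _ j] power_strict_mono) auto
    qed
  qed
  with norms show False by simp
qed

section \<open>The folded Strachey square\<close>

text \<open>
  The sum of the two blocks of either block column of the Strachey square of order \<open>2 * m\<close>.
\<close>

definition folded_strachey :: "nat \<Rightarrow> complex mat" where
  "folded_strachey m = 2 \<cdot>\<^sub>m siamese m + of_nat (3 * m\<^sup>2) \<cdot>\<^sub>m ones_mat m"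

lemma folded_carrier: "folded_strachey m \<in> carrier_mat m m"
  by (simp add: folded_strachey_def siamese_def ones_mat_def)

text \<open>
  Both residues become sawtooth values after subtracting their mean \<open>k\<close>;
  the constants then add up to the mean entry \<open>4 * m\<^sup>2 + 1\<close>.
\<close>

lemma folded_entry:
  assumes k: "k \<ge> 1" and m: "m = 2 * k + 1" and "i < m" "j < m"
  shows "folded_strachey m $$ (i, j) =
    2 * of_nat m * of_int ((int i + (int j + int k + 1)) mod int m - int k)
    + 2 * of_int ((int i + (2 * int j + 1)) mod int m - int k)
    + (4 * of_nat m ^ 2 + 1)"
proof -
  have "(m - 3) div 2 = k - 1" using m by simp
  define P where "P = (i + (j + k + 1)) mod m"
  define Q where "Q = (i + (2 * j + 1)) mod m"
  have intPQ: "int P = (int i + (int j + int k + 1)) mod int m" "int Q = (int i + (2 * int j + 1)) mod int m"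
    unfolding P_def Q_def zmod_int by (simp_all add: algebra_simps)
  have "i + 1 + (j + 1) + (k - 1) = i + (j + k + 1)" "i + 1 + 2 * (j + 1) - 2 = i + (2 * j + 1)"
    using k by simp_all
  with \<open>(m - 3) div 2 = k - 1\<close> have "siamese_entry m (i + 1) (j + 1) = m * P + Q + 1"
    unfolding siamese_entry_def P_def Q_def by (simp only:)
  then have "folded_strachey m $$ (i, j) = 2 * of_nat (m * P + Q + 1) + 3 * of_nat m ^ 2"
    using assms(3,4) by (simp add: folded_strachey_def siamese_def ones_mat_def)
  also have "\<dots> = 2 * of_nat m * (of_nat P - of_nat k) + 2 * (of_nat Q - of_nat k) + (4 * of_nat m ^ 2 + 1)"
    by (simp add: m power2_eq_square algebra_simps)
  also have "of_nat P - of_nat k = complex_of_int ((int i + (int j + int k + 1)) mod int m - int k)"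
    unfolding intPQ[symmetric] by simp
  also have "of_nat Q - of_nat k = complex_of_int ((int i + (2 * int j + 1)) mod int m - int k)"
    unfolding intPQ[symmetric] by simp
  finally show ?thesis .
qed

lemma folded_column_sum:
  assumes k: "k \<ge> 1" and m: "m = 2 * k + 1" and "j < m"
  shows "(\<Sum>i<m. folded_strachey m $$ (i, j)) = magic_sum (2 * m)"
proof -
  have saw: "(\<Sum>i<m. complex_of_int ((int i + r) mod int m - int k)) = 0" for r
  proof -
    have "m > 0" using m by simp
    then have "(\<Sum>i<m. complex_of_int ((int i + r) mod int m - int k)) = (\<Sum>s<m. complex_of_int (int s - int k))"
      by (rule sum_shift_mod)
    then show ?thesis
      unfolding m sum_sawtooth .
  qed
  have "(\<Sum>i<m. folded_strachey m $$ (i, j))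
      = 2 * of_nat m * (\<Sum>i<m. of_int ((int i + (int j + int k + 1)) mod int m - int k))
        + 2 * (\<Sum>i<m. of_int ((int i + (2 * int j + 1)) mod int m - int k))
        + of_nat m * (4 * of_nat m ^ 2 + 1)"
  proof -
    have "(\<Sum>i<m. folded_strachey m $$ (i, j))
        = (\<Sum>i<m. 2 * of_nat m * of_int ((int i + (int j + int k + 1)) mod int m - int k)
          + 2 * of_int ((int i + (2 * int j + 1)) mod int m - int k) + (4 * of_nat m ^ 2 + 1))"
      using assms(3) by (intro sum.cong refl) (simp only: folded_entry[OF k m] lessThan_iff)
    then show ?thesis
      by (simp only: sum.distrib sum_constant card_lessThan distrib_left[of "of_nat m"] flip: sum_distrib_left)
  qed
  then show ?thesis
    unfolding saw by (simp add: magic_sum_def power_mult_distrib)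
qed

text \<open>
  The two terms are the coordinates of \<open>H\<close> and of \<open>H * P / m\<close>: the second residue of the Siamese
  formula uses the same sawtooth as the first at a permuted column, with weight smaller by the
  factor \<open>m\<close>.
\<close>

lemma hartley_folded:
  assumes k: "k \<ge> 1" and m: "m = 2 * k + 1" and j: "0 < j" "j < m" and t: "t < m"
  shows "(\<Sum>i<m. of_real (hartley m j (int i - int k)) * folded_strachey m $$ (i, t))
    = 2 * of_nat m * of_real (sawtooth_coeff m j) * of_real (hartley m j (int t - int k))
      + 2 * of_real (sawtooth_coeff m j) * of_real (hartley m j (2 * int t + 1))"
proof -
  let ?h = "\<lambda>i. complex_of_real (hartley m j (int i - int k))"
  have saw: "(\<Sum>i<m. of_int ((int i + r) mod int m - int k) * ?h i)
      = of_real (sawtooth_coeff m j * hartley m j r)" for r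
    unfolding sum_sawtooth_hartley[OF m j, symmetric] by simp
  have const: "(\<Sum>i<m. ?h i) = 0"
    unfolding of_real_sum[symmetric] sum_hartley_eq_0[OF j] by simp
  have "(\<Sum>i<m. ?h i * folded_strachey m $$ (i, t))
      = (\<Sum>i<m. 2 * of_nat m * (of_int ((int i + (int t + int k + 1)) mod int m - int k) * ?h i)
        + 2 * (of_int ((int i + (2 * int t + 1)) mod int m - int k) * ?h i)
        + (4 * of_nat m ^ 2 + 1) * ?h i)"
    using t by (intro sum.cong refl) (simp add: folded_entry[OF k m] algebra_simps)
  also have "\<dots> = 2 * of_nat m * (\<Sum>i<m. of_int ((int i + (int t + int k + 1)) mod int m - int k) * ?h i)
        + 2 * (\<Sum>i<m. of_int ((int i + (2 * int t + 1)) mod int m - int k) * ?h i)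
        + (4 * of_nat m ^ 2 + 1) * (\<Sum>i<m. ?h i)"
    by (simp only: sum.distrib sum_distrib_left)
  also have "hartley m j (int t + int k + 1) = hartley m j (int t - int k)"
  proof (rule hartley_cong)
    have "int t + int k + 1 - (int t - int k) = int m" using m by simp
    then show "int m dvd int t + int k + 1 - (int t - int k)" by simp
  qed (use m in simp)
  ultimately show ?thesis
    unfolding saw const by simp
qed

text \<open>
  The coordinates \<open>a j\<close> of the eigenvector and \<open>b j\<close> of its permuted copy have equal square sums,
  as \<open>t\<close> and \<open>2 * t + 1\<close> both run through all residues modulo the odd number \<open>m\<close>. Entry sum 0 makes both
  vanish at \<open>j = 0\<close>, so the constant vector never provides the nearby eigenvalue.
\<close>

lemma folded_eigenvalue_near:
  assumes k: "k \<ge> 1" and m: "m = 2 * k + 1"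
    and x: "x \<in> carrier_vec m" "x \<noteq> 0\<^sub>v m"
    and eig: "folded_strachey m *\<^sub>v x = z \<cdot>\<^sub>v x" and sum0: "(\<Sum>i<m. x $ i) = 0"
  shows "\<exists>j. 0 < j \<and> j < m \<and> cmod (z - of_real (2 * real m * sawtooth_coeff m j))
    \<le> 1 / m * cmod (of_real (2 * real m * sawtooth_coeff m j))"
proof -
  have m0: "m > 0" using m by simp
  define a where "a j = (\<Sum>t<m. of_real (hartley m j (int t - int k)) * x $ t)" for j
  define b where "b j = (\<Sum>t<m. of_real (hartley m j (2 * int t + 1)) * x $ t)" for j
  define q where "q j = complex_of_real (2 * real m * sawtooth_coeff m j)" for j
  have eig_i: "(\<Sum>t<m. folded_strachey m $$ (i, t) * x $ t) = z * x $ i" if "i < m" for i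
    using arg_cong[OF eig, of "\<lambda>u. u $ i"] that x(1) folded_carrier[of m]
    by (simp add: scalar_prod_def atLeast0LessThan)
  have ab0: "a 0 = 0" "b 0 = 0"
    using sum0 by (simp_all add: a_def b_def hartley_def)
  have eq: "(z - q j) * a j = of_real (1 / m) * q j * b j" if "j < m" for j
  proof (cases "j = 0")
    case False
    have "z * a j = (\<Sum>i<m. of_real (hartley m j (int i - int k)) * (z * x $ i))"
      by (simp add: a_def sum_distrib_left mult_ac)
    also have "\<dots> = (\<Sum>i<m. \<Sum>t<m. of_real (hartley m j (int i - int k)) * folded_strachey m $$ (i, t) * x $ t)"
    proof (intro sum.cong refl)
      fix i assume "i \<in> {..<m}"
      then have "z * x $ i = (\<Sum>t<m. folded_strachey m $$ (i, t) * x $ t)"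
        using eig_i by simp
      then show "of_real (hartley m j (int i - int k)) * (z * x $ i)
          = (\<Sum>t<m. of_real (hartley m j (int i - int k)) * folded_strachey m $$ (i, t) * x $ t)"
        by (simp only: sum_distrib_left mult.assoc)
    qed
    also have "\<dots> = (\<Sum>t<m. (\<Sum>i<m. of_real (hartley m j (int i - int k)) * folded_strachey m $$ (i, t)) * x $ t)"
      by (subst sum.swap) (simp add: sum_distrib_right)
    also have "\<dots> = (\<Sum>t<m. q j * (of_real (hartley m j (int t - int k)) * x $ t)
        + of_real (1 / m) * q j * (of_real (hartley m j (2 * int t + 1)) * x $ t))"
    proof (intro sum.cong refl)
      fix t assume "t \<in> {..<m}"
      then have "(\<Sum>i<m. of_real (hartley m j (int i - int k)) * folded_strachey m $$ (i, t))
          = 2 * of_nat m * of_real (sawtooth_coeff m j) * of_real (hartley m j (int t - int k))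
            + 2 * of_real (sawtooth_coeff m j) * of_real (hartley m j (2 * int t + 1))"
        using hartley_folded[OF k m _ \<open>j < m\<close>] False by simp
      then show "(\<Sum>i<m. of_real (hartley m j (int i - int k)) * folded_strachey m $$ (i, t)) * x $ t
          = q j * (of_real (hartley m j (int t - int k)) * x $ t)
            + of_real (1 / m) * q j * (of_real (hartley m j (2 * int t + 1)) * x $ t)"
        using m0 by (simp add: q_def ring_distribs)
    qed
    also have "\<dots> = q j * a j + of_real (1 / m) * q j * b j"
      by (simp only: sum.distrib sum_distrib_left a_def b_def)
    finally show ?thesis
      by (simp add: algebra_simps)
  qed (simp add: ab0)
  have normsq_a: "(\<Sum>j<m. (cmod (a j))\<^sup>2) = m * (\<Sum>t<m. (cmod (x $ t))\<^sup>2)"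
    unfolding a_def
  proof (rule hartley_parseval[OF m0])
    fix s t assume *: "s < m" "t < m" "int m dvd (int s - int k) - (int t - int k)"
    then have "int s mod int m = int t mod int m"
      unfolding mod_eq_dvd_iff by simp
    with * show "s = t" by simp
  qed
  have normsq_b: "(\<Sum>j<m. (cmod (b j))\<^sup>2) = m * (\<Sum>t<m. (cmod (x $ t))\<^sup>2)"
    unfolding b_def
  proof (rule hartley_parseval[OF m0])
    fix s t assume *: "s < m" "t < m" "int m dvd (2 * int s + 1) - (2 * int t + 1)"
    then have "int m dvd 2 * (int s - int t)" by simp
    moreover have "coprime (int m) 2"
      using m by simp
    ultimately have "int m dvd int s - int t"
      using coprime_dvd_mult_right_iff by blast
    then have "int s mod int m = int t mod int m"
      unfolding mod_eq_dvd_iff .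
    with * show "s = t" by simp
  qed
  have "\<exists>j\<in>{..<m}. a j \<noteq> 0"
  proof (rule ccontr)
    assume "\<not> ?thesis"
    then have "(\<Sum>t<m. (cmod (x $ t))\<^sup>2) = 0"
      using normsq_a m0 by simp
    then have "x $ t = 0" if "t < m" for t
      using that by (simp add: sum_nonneg_eq_0_iff)
    then have "x = 0\<^sub>v m"
      using x(1) by (intro eq_vecI) auto
    with x(2) show False ..
  qed
  then obtain j where "j < m" "a j \<noteq> 0" "cmod (z - q j) \<le> 1 / m * cmod (q j)"
    using relative_perturbation_bound[of "{..<m}" "1 / m" z q a b] eq normsq_a normsq_b by auto
  moreover from this have "j \<noteq> 0"
    using ab0 by (intro notI) simp
  ultimately show ?thesis
    unfolding q_def by auto
qed

text \<open>
  The reflection \<open>j \<mapsto> m - j\<close> brings the index into \<open>{1..k}\<close>, and the sign \<open>(-1) ^ (j + 1)\<close> is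
  absorbed by the choice between an index of \<open>\<Lambda>\<close> and its negative.
\<close>

lemma sawtooth_coeff_in_Lambda_set:
  assumes m: "m = 2 * k + 1" and j: "0 < j" "j < m"
  shows "complex_of_real (2 * real m * sawtooth_coeff m j) \<in> Lambda_set k"
    and "complex_of_real (2 * real m * sawtooth_coeff m j) \<noteq> 0"
proof -
  have m0: "real m > 0" using m by simp
  have sin: "sin (pi * j / m) > 0"
    using j m0 by (intro sin_gt_zero) (auto simp: field_simps)
  then show "complex_of_real (2 * real m * sawtooth_coeff m j) \<noteq> 0"
    using m0 by (simp add: sawtooth_coeff_def)
  define i where "i = (if j \<le> k then int j else int m - int j)"
  have sin_i: "sin (of_int i * pi / m) = sin (pi * j / m)"
  proof (cases "j \<le> k")
    case False
    then have "of_int i * pi / m = pi - pi * j / m"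
      using m0 by (simp add: i_def field_simps)
    then show ?thesis by simp
  qed (simp add: i_def mult.commute)
  define l where "l = (if even j then - i else i)"
  have "l \<in> {- int k..int k} - {0}"
    using m j by (auto simp: l_def i_def)
  moreover have "2 * real m * sawtooth_coeff m j = real (2 * m) ^ 2 / (4 * sin (of_int l * pi / m))"
    using sin_i by (auto simp: sawtooth_coeff_def l_def power2_eq_square)
  ultimately show "complex_of_real (2 * real m * sawtooth_coeff m j) \<in> Lambda_set k"
    unfolding Lambda_set_def Let_def m[symmetric] mem_Collect_eq
    by (intro exI[of _ l] conjI) (simp_all only:)
qed

section \<open>The difference of the upper blocks\<close>

text \<open>
  Difference of the two upper blocks in every row but the middle one, in units of \<open>m\<^sup>2\<close>.
\<close>

definition swap_row :: "nat \<Rightarrow> nat \<Rightarrow> complex" where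
  "swap_row k j = (if j < k then 1 else if j \<le> k + 1 then - 2 else - 1)"

text \<open>
  Together with \<open>diff_right\<close> a rank factorisation of the difference of the upper blocks: the first
  factor carries the common row and the correction of the middle row.
\<close>

definition diff_left :: "nat \<Rightarrow> complex mat" where
  "diff_left k = mat (2 * k + 1) 2 (\<lambda>(i, c). of_nat ((2 * k + 1)\<^sup>2) * (if c = 0 then 1 else if i = k then 3 else 0))"

definition diff_right :: "nat \<Rightarrow> complex mat" where
  "diff_right k = mat 2 (2 * k + 1) (\<lambda>(c, j). if c = 0 then swap_row k j
     else if j = k then 1 else if j = 0 then - 1 else 0)"

lemma diff_carrier:
  assumes "m = 2 * k + 1"
  shows "diff_left k \<in> carrier_mat m 2" "diff_right k \<in> carrier_mat 2 m"
  by (simp_all add: diff_left_def diff_right_def assms)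

lemma strachey_entry:
  assumes m: "m = 2 * k + 1" and i: "i < m" and j: "j < 2 * m"
  shows "strachey k $$ (i, j) = (if (i + 1, j + 1) \<in> strachey_swaps k
      then strachey_start m $$ (i + m, j) else strachey_start m $$ (i, j))"
    and "strachey k $$ (i + m, j) = (if (i + 1, j + 1) \<in> strachey_swaps k
      then strachey_start m $$ (i, j) else strachey_start m $$ (i + m, j))"
  using i j by (simp_all add: strachey_def Let_def m)

lemma strachey_start_entry:
  assumes "i < m" "j < m"
  shows "strachey_start m $$ (i, j) = siamese m $$ (i, j)"
    and "strachey_start m $$ (i, j + m) = siamese m $$ (i, j) + 2 * of_nat m ^ 2"
    and "strachey_start m $$ (i + m, j) = siamese m $$ (i, j) + 3 * of_nat m ^ 2"
    and "strachey_start m $$ (i + m, j + m) = siamese m $$ (i, j) + of_nat m ^ 2"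
  using assms by (simp_all add: strachey_start_def siamese_def ones_mat_def)

lemma strachey_block_row_sum:
  assumes m: "m = 2 * k + 1" and i: "i < m" and j: "j < m"
  shows "strachey k $$ (i, j) + strachey k $$ (i + m, j) = folded_strachey m $$ (i, j)"
    and "strachey k $$ (i, j + m) + strachey k $$ (i + m, j + m) = folded_strachey m $$ (i, j)"
proof -
  have dbl: "folded_strachey m $$ (i, j) = 2 * siamese m $$ (i, j) + 3 * of_nat m ^ 2"
    using i j by (simp add: folded_strachey_def siamese_def ones_mat_def)
  show "strachey k $$ (i, j) + strachey k $$ (i + m, j) = folded_strachey m $$ (i, j)"
    using strachey_entry[OF m i, of j] strachey_start_entry[OF i j] j dbl by simp
  show "strachey k $$ (i, j + m) + strachey k $$ (i + m, j + m) = folded_strachey m $$ (i, j)"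
    using strachey_entry[OF m i, of "j + m"] strachey_start_entry[OF i j] j dbl by simp
qed

text \<open>
  With respect to the untouched difference \<open>- 2 * m\<^sup>2\<close>, an interchange in the left half of a row adds
  \<open>3 * m\<^sup>2\<close> and one in the right half adds \<open>m\<^sup>2\<close>. Every row gives the pattern \<open>swap_row\<close>, except that in the middle
  row the left interchange sits in column \<open>k\<close> instead of column 0.
\<close>

lemma strachey_block_difference:
  assumes k: "k \<ge> 1" and m: "m = 2 * k + 1" and i: "i < m" and j: "j < m"
  shows "strachey k $$ (i, j) - strachey k $$ (i, j + m) = (diff_left k * diff_right k) $$ (i, j)"
proof -
  have left: "(i + 1, j + 1) \<in> strachey_swaps k \<longleftrightarrow>
      0 < j \<and> j < k \<or> j = 0 \<and> i \<noteq> k \<or> j = k \<and> i = k"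
    using i j m k by (auto simp: strachey_swaps_def Let_def)
  have right: "(i + 1, j + m + 1) \<in> strachey_swaps k \<longleftrightarrow> k + 1 < j"
    using i j m k by (auto simp: strachey_swaps_def Let_def)
  have "strachey k $$ (i, j) - strachey k $$ (i, j + m)
      = of_nat m ^ 2 * (3 * of_bool ((i + 1, j + 1) \<in> strachey_swaps k)
        + of_bool ((i + 1, j + m + 1) \<in> strachey_swaps k) - 2)"
    using strachey_entry(1)[OF m i, of j] strachey_entry(1)[OF m i, of "j + m"]
      strachey_start_entry[OF i j] j by (simp add: algebra_simps)
  also have "\<dots> = of_nat m ^ 2 * (swap_row k j
      + (if i = k then 3 * (if j = k then 1 else if j = 0 then - 1 else 0) else 0))"
    unfolding left right using k by (auto simp: swap_row_def)
  also have "\<dots> = (diff_left k * diff_right k) $$ (i, j)"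
    using i j m k
    by (simp add: diff_left_def diff_right_def scalar_prod_def numeral_2_eq_2 power2_eq_square algebra_simps)
  finally show ?thesis .
qed

lemma sum_swap_row:
  assumes "k \<ge> 1"
  shows "(\<Sum>j<2 * k + 1. swap_row k j) = - 3"
proof -
  have "{..<2 * k + 1} = ({..<k} \<union> {k, k + 1}) \<union> {k + 2..<2 * k + 1}"
    using assms by auto
  then have "(\<Sum>j<2 * k + 1. swap_row k j) = sum (swap_row k) (({..<k} \<union> {k, k + 1}) \<union> {k + 2..<2 * k + 1})"
    by (rule arg_cong)
  also have "\<dots> = sum (swap_row k) ({..<k} \<union> {k, k + 1}) + (\<Sum>j = k + 2..<2 * k + 1. swap_row k j)"
    by (rule sum.union_disjoint) auto
  also have "sum (swap_row k) ({..<k} \<union> {k, k + 1}) = (\<Sum>j<k. swap_row k j) + (\<Sum>j\<in>{k, k + 1}. swap_row k j)"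
    by (rule sum.union_disjoint) auto
  also have "(\<Sum>j<k. swap_row k j) + (\<Sum>j\<in>{k, k + 1}. swap_row k j)
      + (\<Sum>j = k + 2..<2 * k + 1. swap_row k j) = of_nat k - 4 - of_nat (k - 1)"
    by (simp add: swap_row_def)
  also have "\<dots> = - 3"
    using assms by (simp add: of_nat_diff)
  finally show ?thesis .
qed

lemma diff_right_mult_vec:
  assumes k: "k \<ge> 1" and m: "m = 2 * k + 1" and x: "x \<in> carrier_vec m"
  shows "(diff_right k *\<^sub>v x) $ 0 = (\<Sum>j<m. swap_row k j * x $ j)"
    and "(diff_right k *\<^sub>v x) $ 1 = x $ k - x $ 0"
proof -
  show "(diff_right k *\<^sub>v x) $ 0 = (\<Sum>j<m. swap_row k j * x $ j)"
    using x m by (simp add: diff_right_def scalar_prod_def atLeast0LessThan)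
  have "(diff_right k *\<^sub>v x) $ 1 = (\<Sum>j<m. (if j = k then x $ k else 0) - (if j = 0 then x $ 0 else 0))"
    using x m k by (auto simp: diff_right_def scalar_prod_def atLeast0LessThan intro!: sum.cong)
  also have "\<dots> = x $ k - x $ 0"
    using m by (simp add: sum_subtractf)
  finally show "(diff_right k *\<^sub>v x) $ 1 = x $ k - x $ 0" .
qed

lemma diff_mult_vec:
  assumes k: "k \<ge> 1" and m: "m = 2 * k + 1" and x: "x \<in> carrier_vec m" and i: "i < m"
  shows "((diff_left k * diff_right k) *\<^sub>v x) $ i = of_nat (m\<^sup>2) *
    ((\<Sum>j<m. swap_row k j * x $ j) + (if i = k then 3 * (x $ k - x $ 0) else 0))"
proof -
  have L: "diff_left k \<in> carrier_mat m 2" and R: "diff_right k \<in> carrier_mat 2 m"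
    by (rule diff_carrier[OF m])+
  have "((diff_left k * diff_right k) *\<^sub>v x) $ i = (\<Sum>c<2. diff_left k $$ (i, c) * (diff_right k *\<^sub>v x) $ c)"
    using L R x i by (simp add: assoc_mult_mat_vec[OF L R x] scalar_prod_def atLeast0LessThan del: index_mult_mat_vec)
      (simp add: scalar_prod_def atLeast0LessThan)
  also have "\<dots> = diff_left k $$ (i, 0) * (diff_right k *\<^sub>v x) $ 0 + diff_left k $$ (i, 1) * (diff_right k *\<^sub>v x) $ 1"
    by (simp only: numeral_2_eq_2 One_nat_def sum.lessThan_Suc lessThan_0 sum.empty add_0)
  also have "\<dots> = of_nat (m\<^sup>2) * ((\<Sum>j<m. swap_row k j * x $ j) + (if i = k then 3 * (x $ k - x $ 0) else 0))"
    unfolding diff_right_mult_vec[OF k m x] using i m by (simp add: diff_left_def algebra_simps)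
  finally show ?thesis .
qed

text \<open>
  The swapped product is upper triangular because the middle-row correction has entry sum 0.
\<close>

lemma char_poly_diff:
  assumes k: "k \<ge> 1" and m: "m = 2 * k + 1"
  shows "char_poly (diff_left k * diff_right k)
    = [:0, 1:] ^ (2 * k - 1) * ([:of_nat (3 * m\<^sup>2), 1:] * [:- of_nat (3 * m\<^sup>2), 1:])"
proof -
  let ?\<mu> = "complex_of_nat (3 * m\<^sup>2)"
  have L: "diff_left k \<in> carrier_mat m 2" and R: "diff_right k \<in> carrier_mat 2 m"
    by (rule diff_carrier[OF m])+
  let ?S = "diff_right k * diff_left k"
  have S: "?S \<in> carrier_mat 2 2"
    using L R by simp
  have S_entry: "?S $$ (c, d) = (diff_right k *\<^sub>v col (diff_left k) d) $ c" if "c < 2" "d < 2" for c d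
    using that L R by simp
  have col: "col (diff_left k) d \<in> carrier_vec m" for d
    using L col_dim[of "diff_left k" d] by simp
  have "?S $$ (0, 0) = of_nat (m\<^sup>2) * (\<Sum>j<m. swap_row k j)"
    using L m unfolding S_entry[of 0 0, simplified] diff_right_mult_vec(1)[OF k m col] sum_distrib_left
    by (intro sum.cong) (auto simp: diff_left_def)
  then have S00: "?S $$ (0, 0) = - ?\<mu>"
    unfolding m sum_swap_row[OF k] by simp
  have two: "(0::nat) < 2" "(1::nat) < 2" by simp_all
  have S1: "?S $$ (1, d) = col (diff_left k) d $ k - col (diff_left k) d $ 0" if "d < 2" for d
    unfolding S_entry[OF two(2) that] by (rule diff_right_mult_vec(2)[OF k m col])
  have "col (diff_left k) 0 $ k - col (diff_left k) 0 $ 0 = 0"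
    "col (diff_left k) 1 $ k - col (diff_left k) 1 $ 0 = ?\<mu>"
    using m k by (simp_all add: diff_left_def)
  then have S10: "?S $$ (1, 0) = 0" and S11: "?S $$ (1, 1) = ?\<mu>"
    unfolding S1[OF two(1)] S1[OF two(2)] by simp_all
  have "upper_triangular ?S"
    unfolding upper_triangular_def using S10 S by (auto simp: less_Suc_eq numeral_2_eq_2)
  moreover have "diag_mat ?S = [- ?\<mu>, ?\<mu>]"
    using S S00 S11 by (simp add: diag_mat_def numeral_2_eq_2 del: index_mult_mat)
  ultimately have cpS: "char_poly ?S = [:?\<mu>, 1:] * [:- ?\<mu>, 1:]"
    using char_poly_upper_triangular[OF S] by simp
  have "m = 2 + (2 * k - 1)" using m k by simp
  then have "[:0, 1 :: complex:] ^ m = [:0, 1:] ^ 2 * [:0, 1:] ^ (2 * k - 1)"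
    by (metis power_add)
  with sylvester_char_poly[OF L R] have "[:0, 1:] ^ 2 * char_poly (diff_left k * diff_right k)
      = [:0, 1:] ^ 2 * ([:0, 1:] ^ (2 * k - 1) * char_poly ?S)"
    by (simp only: mult.assoc)
  then show ?thesis
    unfolding cpS by (subst (asm) mult_left_cancel) auto
qed

lemma strachey_block_structure:
  assumes k: "k \<ge> 1" and m: "m = 2 * k + 1"
  shows "char_poly (strachey k) = char_poly (diff_left k * diff_right k) * char_poly (folded_strachey m)"
    and "y \<in> carrier_vec m \<Longrightarrow> strachey k *\<^sub>v (y @\<^sub>v - y)
      = ((diff_left k * diff_right k) *\<^sub>v y) @\<^sub>v - ((diff_left k * diff_right k) *\<^sub>v y)"
proof -
  let ?R = "diff_left k * diff_right k" and ?N = "folded_strachey m"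
  obtain A B C D where split: "split_block (strachey k) m m = (A, B, C, D)"
    by (metis prod_cases4)
  have dims: "dim_row (strachey k) = m + m" "dim_col (strachey k) = m + m"
    by (simp_all add: strachey_def Let_def m)
  have A: "A \<in> carrier_mat m m" and B: "B \<in> carrier_mat m m" and C: "C \<in> carrier_mat m m"
    and D: "D \<in> carrier_mat m m" and M_eq: "strachey k = four_block_mat A B C D"
    using split_block[OF split dims] by auto
  have R: "?R \<in> carrier_mat m m" and N: "?N \<in> carrier_mat m m"
    using diff_carrier[OF m] folded_carrier by auto
  have entry: "strachey k $$ (i, j) = A $$ (i, j)" "strachey k $$ (i, j + m) = B $$ (i, j)"
    "strachey k $$ (i + m, j) = C $$ (i, j)" "strachey k $$ (i + m, j + m) = D $$ (i, j)"
    if "i < m" "j < m" for i j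
    using that A B C D by (simp_all add: M_eq)
  have A_eq: "A = ?R + B * 1\<^sub>m m"
  proof (rule eq_matI)
    fix i j assume "i < dim_row (?R + B * 1\<^sub>m m)" "j < dim_col (?R + B * 1\<^sub>m m)"
    then have ij: "i < m" "j < m" using B by auto
    have "A $$ (i, j) = ?R $$ (i, j) + B $$ (i, j)"
      using strachey_block_difference[OF k m ij] entry[OF ij] by (simp add: diff_eq_eq)
    then show "A $$ (i, j) = (?R + B * 1\<^sub>m m) $$ (i, j)"
      using ij B R by simp
  qed (use A B in auto)
  have left: "1\<^sub>m m * A + C = ?N * 1\<^sub>m m" and right: "1\<^sub>m m * B + D = ?N"
    using A B C D N strachey_block_row_sum[OF m] entry by (auto intro!: eq_matI)
  note block = R B C D one_carrier_mat N A_eq left right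
  show "char_poly (strachey k) = char_poly ?R * char_poly ?N"
    unfolding M_eq by (rule char_poly_intertwined_block[OF block])
  assume y: "y \<in> carrier_vec m"
  then have "?R *\<^sub>v y \<in> carrier_vec m" using R by auto
  with y show "strachey k *\<^sub>v (y @\<^sub>v - y) = (?R *\<^sub>v y) @\<^sub>v - (?R *\<^sub>v y)"
    using mult_vec_intertwined_block[OF block y] by (simp add: M_eq)
qed

text \<open>
  The hypothesis \<open>eig\<close> is the eigenvalue equation for the difference of the upper blocks, written
  out entry by entry.
\<close>

lemma strachey_antisymmetric_eigenvector:
  assumes k: "k \<ge> 1" and m: "m = 2 * k + 1" and y: "y \<in> carrier_vec m" "y $ 0 \<noteq> 0"
    and eig: "\<And>i. i < m \<Longrightarrow> of_nat (m\<^sup>2) *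
      ((\<Sum>j<m. swap_row k j * y $ j) + (if i = k then 3 * (y $ k - y $ 0) else 0)) = z * y $ i"
  shows "eigenvector (strachey k) (y @\<^sub>v - y) z"
proof -
  have "(diff_left k * diff_right k) *\<^sub>v y = z \<cdot>\<^sub>v y"
    using y(1) diff_mult_vec[OF k m y(1)] eig
    by (intro eq_vecI) (auto simp: diff_left_def m simp del: index_mult_mat_vec)
  then have "strachey k *\<^sub>v (y @\<^sub>v - y) = (z \<cdot>\<^sub>v y) @\<^sub>v - (z \<cdot>\<^sub>v y)"
    using strachey_block_structure(2)[OF k m y(1)] by simp
  also have "\<dots> = z \<cdot>\<^sub>v (y @\<^sub>v - y)"
    by (intro eq_vecI) auto
  finally have "strachey k *\<^sub>v (y @\<^sub>v - y) = z \<cdot>\<^sub>v (y @\<^sub>v - y)" .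
  moreover have "y @\<^sub>v - y \<noteq> 0\<^sub>v (2 * m)"
  proof
    assume "y @\<^sub>v - y = 0\<^sub>v (2 * m)"
    then have "(y @\<^sub>v - y) $ 0 = 0" using m by simp
    with y m show False by simp
  qed
  moreover have "dim_row (strachey k) = 2 * m"
    by (simp add: strachey_def Let_def m)
  ultimately show ?thesis
    using append_carrier_vec[of y m "- y" m] y(1) by (simp add: eigenvector_def mult_2)
qed

section \<open>The spectrum of the Strachey square\<close>

theorem theorem4p1:
  fixes k m n :: nat and M :: "complex mat" and v w :: "complex vec"
    and \<mu> :: complex and rest :: "complex multiset"
  assumes "k \<ge> 1"
  defines "m \<equiv> 2 * k + 1" and "n \<equiv> 2 * m"
  defines "M \<equiv> strachey k"
  defines "\<mu> \<equiv> of_nat (3 * m\<^sup>2)"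
  defines "v \<equiv> ones_vec m"
    and "w \<equiv> ones_vec m - 3 \<cdot>\<^sub>v unit_vec m k"
  defines "rest \<equiv> nontrivial_eigenvalues M - ({#- \<mu>, \<mu>#} + replicate_mset (2 * k - 1) 0)"
  shows "(eigenvector M (v @\<^sub>v - v) (- \<mu>) \<and> eigenvector M (w @\<^sub>v - w) \<mu> \<and>
            {#- \<mu>, \<mu>#} \<subseteq># nontrivial_eigenvalues M) \<and>
         replicate_mset (2 * k - 1) 0 \<subseteq># nontrivial_eigenvalues M \<and>
         (size rest = 2 * k \<and>
            approximated_by (2 / real n) (set_mset rest) (Lambda_set k))"
proof -
  note k = \<open>k \<ge> 1\<close> and m = meta_eq_to_obj_eq[OF m_def]
  have m0: "m > 0" and "k < m" by (simp_all add: m_def)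
  have col_sum: "(\<Sum>j<m. swap_row k j) = - 3"
    unfolding m_def by (rule sum_swap_row[OF k])
  have eig_v: "eigenvector M (v @\<^sub>v - v) (- \<mu>)"
    unfolding M_def
    by (rule strachey_antisymmetric_eigenvector[OF k m])
      (use m0 col_sum in \<open>auto simp: v_def ones_vec_def \<mu>_def m_def\<close>)
  have w: "w \<in> carrier_vec m" "\<And>i. i < m \<Longrightarrow> w $ i = (if i = k then - 2 else 1)"
    by (auto simp: w_def ones_vec_def m_def unit_vec_def)
  have "(\<Sum>j<m. swap_row k j * w $ j) = (\<Sum>j<m. swap_row k j - (if j = k then 3 * swap_row k k else 0))"
    by (intro sum.cong) (auto simp: w)
  also have "\<dots> = (\<Sum>j<m. swap_row k j) - 3 * swap_row k k"
    using \<open>k < m\<close> by (simp add: sum_subtractf)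
  also have "\<dots> = 3"
    unfolding col_sum by (simp add: swap_row_def)
  finally have w_sum: "(\<Sum>j<m. swap_row k j * w $ j) = 3" .
  have eig_w: "eigenvector M (w @\<^sub>v - w) \<mu>"
    unfolding M_def
  proof (rule strachey_antisymmetric_eigenvector[OF k m w(1)])
    show "w $ 0 \<noteq> 0" using w(2)[of 0] m0 k by auto
    have "w $ k - w $ 0 = - 3" using w(2)[of 0] w(2)[of k] k by (simp add: m_def)
    then show "of_nat (m\<^sup>2) * ((\<Sum>j<m. swap_row k j * w $ j) + (if i = k then 3 * (w $ k - w $ 0) else 0))
        = \<mu> * w $ i" if "i < m" for i
      unfolding w_sum using w(2)[OF that] by (simp add: \<mu>_def)
  qed
  have dim: "dim_row M = 2 * m"
    by (simp add: M_def strachey_def Let_def m_def)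
  have "folded_strachey m \<in> carrier_mat (Suc (2 * k)) (Suc (2 * k))"
    using folded_carrier[of m] by (simp add: m_def)
  moreover have "(\<Sum>i<Suc (2 * k). folded_strachey m $$ (i, j)) = magic_sum (2 * m)" if "j < Suc (2 * k)" for j
    using folded_column_sum[OF k m, of j] that by (simp add: m_def)
  ultimately obtain R where R: "R \<in> carrier_mat (2 * k) (2 * k)"
    and cp: "char_poly (folded_strachey m) = char_poly R * [:- magic_sum (2 * m), 1:]"
    and eigvec: "\<And>z. poly (char_poly R) z = 0 \<Longrightarrow>
      \<exists>x. x \<in> carrier_vec (Suc (2 * k)) \<and> x \<noteq> 0\<^sub>v (Suc (2 * k)) \<and>
        folded_strachey m *\<^sub>v x = z \<cdot>\<^sub>v x \<and> (\<Sum>i<Suc (2 * k). x $ i) = 0"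
    by (rule const_column_sum_deflation) (assumption, rule that, assumption, assumption, blast)
  have degR: "degree (char_poly R) = 2 * k" and R0: "char_poly R \<noteq> 0"
    using degree_monic_char_poly[OF R] by auto
  have "char_poly M = [:0, 1:] ^ (2 * k - 1) * ([:\<mu>, 1:] * [:- \<mu>, 1:])
      * (char_poly R * [:- magic_sum (2 * m), 1:])"
    unfolding M_def strachey_block_structure(1)[OF k m] char_poly_diff[OF k m] cp \<mu>_def ..
  also have "proots \<dots> = replicate_mset (2 * k - 1) 0 + {#- \<mu>, \<mu>#} + (proots (char_poly R) + {#magic_sum (2 * m)#})"
    using R0 by (simp add: proots_mult proots_power del: mult_pCons_left mult_pCons_right)
  finally have spectrum: "nontrivial_eigenvalues M = replicate_mset (2 * k - 1) 0 + {#- \<mu>, \<mu>#} + proots (char_poly R)"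
    unfolding nontrivial_eigenvalues_def dim by simp
  have rest: "rest = proots (char_poly R)"
    unfolding rest_def spectrum by (simp add: add.commute add.left_commute)
  have "approximated_by (2 / real n) (set_mset rest) (Lambda_set k)"
    unfolding approximated_by_def
  proof
    fix z assume "z \<in># rest"
    then have "poly (char_poly R) z = 0"
      using R0 by (simp add: rest)
    from eigvec[OF this] obtain x where "x \<in> carrier_vec m" "x \<noteq> 0\<^sub>v m"
      "folded_strachey m *\<^sub>v x = z \<cdot>\<^sub>v x" "(\<Sum>i<m. x $ i) = 0"
      by (auto simp: m_def)
    from folded_eigenvalue_near[OF k m this] obtain j where j: "0 < j" "j < m"
      and near: "cmod (z - of_real (2 * real m * sawtooth_coeff m j))
        \<le> 1 / m * cmod (of_real (2 * real m * sawtooth_coeff m j))"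
      by blast
    let ?q = "complex_of_real (2 * real m * sawtooth_coeff m j)"
    have q: "?q \<in> Lambda_set k" "?q \<noteq> 0"
      using sawtooth_coeff_in_Lambda_set[OF m j] by blast+
    have "cmod (z - ?q) / cmod ?q \<le> 2 / real n"
      using near q(2) by (subst pos_divide_le_eq) (auto simp: n_def)
    with q show "\<exists>q\<in>Lambda_set k. q \<noteq> 0 \<and> cmod (z - q) / cmod q \<le> 2 / real n"
      by blast
  qed
  moreover have "size rest = 2 * k"
    unfolding rest size_proots_complex degR ..
  ultimately show ?thesis
    using eig_v eig_w by (auto simp: spectrum)
qed

end
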